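(* Let $1<\beta<2$ and $\lambda>0$, and let $$p_{\beta,\lambda}(x)=\frac{\beta\lambda^{1/\beta}}{2\Gamma(1/\beta)}e^{-\lambda|x|^\beta},\qquad F(x)=\int_{-\infty}^xp_{\beta,\lambda}(t)\,dt,\qquad x\in\mathbb R .$$ For $z\in\mathbb R$ let $$f_z(x)=\begin{cases}\dfrac{F(x)(1-F(z))}{p_{\beta,\lambda}(x)},&x\le z,\\[2mm]\dfrac{F(z)(1-F(x))}{p_{\beta,\lambda}(x)},&x>z.\end{cases}$$ Put $a:=1/\beta\in(\tfrac12,1)$ and $P_a(u):=\gamma(a,u)/\Gamma(a)$ for $u\ge0$, where $\gamma(a,u)=\int_0^ut^{a-1}e^{-t}\,dt$. Then the exact indicator-solution envelope $$H_{\beta,\lambda}(x):=\sup_{z\in\mathbb R}|f_z(x)|=\frac{F(x)\{1-F(x)\}}{p_{\beta,\lambda}(x)}$$ has exactly two global maximizers $\pm x_{\beta,\lambda}$ on $\mathbb R$, where $$x_{\beta,\lambda}=\left(\frac{u_\beta}{\lambda}\right)^{1/\beta}$$ and $u_\beta$ is the unique positive solution $u$ of $$2P_a(u)P_a'(u)=1-P_a(u)^2 .$$ Consequently, $$C_{\mathrm K}(\beta,\lambda):=\sup_{z\in\mathbb R}\|f_z\|_\infty=\frac{\Gamma(a)}{2\beta\lambda^a}e^{u_\beta}\{1-P_a(u_\beta)^2\}=\frac{P_a(u_\beta)\,u_\beta^{a-1}}{\beta\lambda^a}>\frac1{4p_{\beta,\lambda}(0)} .$$ Moreover, with $g(x)=\beta\lambda\,\operatorname{sgn}(x)|x|^{\beta-1}$,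 $$\sup_{z\in\mathbb R}\|f_z'\|_\infty=1,\qquad \sup_{z\in\mathbb R}\|g f_z\|_\infty=1 .$$
   Context: $\|\cdot\|_\infty$ denotes the supremum norm over $x\in\mathbb R$. The function $f_z$ is the bounded solution of the Stein equation $f_z'(x)-g(x)f_z(x)=\mathbf 1_{(-\infty,z]}(x)-F(z)$; its derivative $f_z'$ is understood on $\mathbb R\setminus\{z\}$ and $\|f_z'\|_\infty$ is the essential supremum of $|f_z'|$, equivalently its supremum over $\mathbb R\setminus\{z\}$. *)

theory Defs
  imports "HOL-Analysis.Analysis" "HOL-Probability.Essential_Supremum"
begin

definition gg_density :: "real \<Rightarrow> real \<Rightarrow> real \<Rightarrow> real" where
  "gg_density \<beta> lam x =
     \<beta> * lam powr (1 / \<beta>) / (2 * Gamma (1 / \<beta>)) * exp (- lam * \<bar>x\<bar> powr \<beta>)"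

definition gg_cdf :: "real \<Rightarrow> real \<Rightarrow> real \<Rightarrow> real" where
  "gg_cdf \<beta> lam x = integral {..x} (gg_density \<beta> lam)"

definition stein_sol :: "real \<Rightarrow> real \<Rightarrow> real \<Rightarrow> real \<Rightarrow> real" where
  "stein_sol \<beta> lam z x =
     (if x \<le> z
      then gg_cdf \<beta> lam x * (1 - gg_cdf \<beta> lam z) / gg_density \<beta> lam x
      else gg_cdf \<beta> lam z * (1 - gg_cdf \<beta> lam x) / gg_density \<beta> lam x)"

definition stein_g :: "real \<Rightarrow> real \<Rightarrow> real \<Rightarrow> real" where
  "stein_g \<beta> lam x = \<beta> * lam * sgn x * \<bar>x\<bar> powr (\<beta> - 1)"

(* The value of the integrand at t = 0 is irrelevant (0 powr _ = 0 in HOL). *)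
definition lower_inc_Gamma :: "real \<Rightarrow> real \<Rightarrow> real" where
  "lower_inc_Gamma a u = integral {0..u} (\<lambda>t. t powr (a - 1) * exp (- t))"

definition reg_Gamma :: "real \<Rightarrow> real \<Rightarrow> real" where
  "reg_Gamma a u = lower_inc_Gamma a u / Gamma a"

(* Suprema are taken in the extended reals, so that they are meaningful
   without presupposing boundedness. *)
definition sup_norm :: "(real \<Rightarrow> real) \<Rightarrow> ereal" where
  "sup_norm h = (SUP x. ereal \<bar>h x\<bar>)"

(* For the derivative of the Stein solution, which exists off the point z only: the value
   that deriv takes at z lies on a null set and does not matter. *)
definition ess_sup_norm :: "(real \<Rightarrow> real) \<Rightarrow> ereal" where
  "ess_sup_norm h = esssup lborel (\<lambda>x. ereal \<bar>h x\<bar>)"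

definition stein_envelope :: "real \<Rightarrow> real \<Rightarrow> real \<Rightarrow> ereal" where
  "stein_envelope \<beta> lam x = (SUP z. ereal \<bar>stein_sol \<beta> lam z x\<bar>)"

definition kolmogorov_const :: "real \<Rightarrow> real \<Rightarrow> ereal" where
  "kolmogorov_const \<beta> lam = (SUP z. sup_norm (stein_sol \<beta> lam z))"

definition crit_eq :: "real \<Rightarrow> real \<Rightarrow> bool" where
  "crit_eq a u \<longleftrightarrow> 2 * reg_Gamma a u * deriv (reg_Gamma a) u = 1 - (reg_Gamma a u)\<^sup>2"

definition crit_u :: "real \<Rightarrow> real" where
  "crit_u \<beta> = (THE u. 0 < u \<and> crit_eq (1 / \<beta>) u)"

definition crit_x :: "real \<Rightarrow> real \<Rightarrow> real" where
  "crit_x \<beta> lam = (crit_u \<beta> / lam) powr (1 / \<beta>)"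

end

theory Submission
  imports Defs "HOL-Real_Asymp.Real_Asymp"
begin

text \<open>
  Write \<open>P\<close> for \<open>reg_Gamma a\<close> and \<open>q = P'\<close>. For fixed \<open>x\<close> the Stein solution is largest at \<open>z = x\<close>, and in the
  variable \<open>u = lam * |x| powr \<beta>\<close> the envelope is a constant multiple of \<open>exp u * (1 - P(u)^2)\<close>, with derivative
  \<open>exp u * D(u)\<close> for \<open>D = 1 - P^2 - 2 P q\<close>. Here \<open>D' = - (2 q / u) * E\<close> with \<open>E = u q - (1 - a) P\<close> and
  \<open>E' = q * (2 a - 1 - u)\<close>. As \<open>a > 1/2\<close>, \<open>E\<close> rises from \<open>0\<close> and then falls to \<open>a - 1 < 0\<close>, so it changes sign
  once; hence \<open>D\<close> falls from \<open>1\<close> to a negative value and then rises to its limit \<open>0\<close>, so it also changes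
  sign once, and this is the unique critical point.

  Both remaining suprema reduce to the Mills ratio \<open>g (1 - F) / p\<close>, which at \<open>x > 0\<close> equals \<open>(1 - P) / q\<close>
  and lies between \<open>1 - (1 - a) / u\<close> and \<open>1\<close>; the values at \<open>x = z\<close> for large \<open>z\<close> show that the bound \<open>1\<close> is sharp.
\<close>

section \<open>Calculus and essential suprema\<close>

text \<open>Meant for expressions in the Gamma density, which blows up at 0 when
  \<open>a < 1\<close>: differentiability covers the open half-line, and a one-sided limit supplies
  continuity at 0.\<close>

lemma continuous_on_nonneg_realI:
  fixes f :: "real \<Rightarrow> real"
  assumes "\<And>x. 0 < x \<Longrightarrow> isCont f x" and "(f \<longlongrightarrow> f 0) (at_right 0)" and "A \<subseteq> {0..}"
  shows "continuous_on A f"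
proof -
  have "continuous (at x within {0..}) f" if "0 \<le> x" for x
    using assms(1)[of x] assms(2) that
    by (cases "x = 0")
      (auto simp: continuous_within at_within_Ici_at_right intro: tendsto_within_subset)
  then show ?thesis
    using assms(3) by (auto simp: continuous_on_eq_continuous_within intro: continuous_within_subset)
qed

text \<open>Nonnegativity lets the limits of \<open>G\<close> yield integrability as well as the
  value. The underlying theorem treats the open interval, so the endpoint \<open>x\<close> is added
  as a negligible set.\<close>

lemma integral_atMost_FTC_nonneg:
  fixes f G :: "real \<Rightarrow> real"
  assumes der: "\<And>y. (G has_real_derivative f y) (at y)"
    and cont: "\<And>y. isCont f y" and nonneg: "\<And>y. 0 \<le> f y"
    and lim: "(G \<longlongrightarrow> A) at_bot"
  shows "integral {..x} f = G x - A"
proof -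
  have G: "(G \<longlongrightarrow> G x) (at_left x)"
    using DERIV_isCont[OF der[of x]] by (simp add: isCont_def filterlim_at_split)
  have int: "set_integrable lborel (einterval (-\<infinity>) (ereal x)) f"
    and eq: "(LBINT y=-\<infinity>..ereal x. f y) = G x - A"
    using interval_integral_FTC_nonneg[of "-\<infinity>" "ereal x" G f A "G x"] der cont nonneg lim G
    by (auto simp: ereal_tendsto_simps)
  have "integral {..<x} f = G x - A"
    using set_borel_integral_eq_integral(2)[OF int] eq
    by (simp add: interval_lebesgue_integral_def)
  moreover have "integral {..x} f = integral {..<x} f"
  proof (rule integral_spike_set)
    have "{y \<in> {..x} - {..<x}. f y \<noteq> 0} \<subseteq> {x}" by auto
    then show "negligible {y \<in> {..x} - {..<x}. f y \<noteq> 0}"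
      using negligible_subset negligible_sing by blast
  qed (auto simp: set_diff_eq intro: negligible_subset[OF negligible_empty])
  ultimately show ?thesis by simp
qed

text \<open>Away from 0 this is the power rule on each half-line. At 0 the difference quotient has
  modulus \<open>\<bar>h\<bar> powr (b - 1)\<close>, which vanishes in the limit because
  \<open>b > 1\<close>.\<close>

lemma DERIV_abs_powr:
  fixes b x :: real
  assumes "1 < b"
  shows "((\<lambda>x. \<bar>x\<bar> powr b) has_real_derivative b * sgn x * \<bar>x\<bar> powr (b - 1)) (at x)"
proof (cases x "0::real" rule: linorder_cases)
  case equal
  have "((\<lambda>h::real. \<bar>h\<bar> powr (b - 1)) \<longlongrightarrow> \<bar>0\<bar> powr (b - 1)) (at 0)"
    using assms by (intro tendsto_powr' tendsto_intros) auto
  then have "((\<lambda>h::real. \<bar>h\<bar> powr (b - 1)) \<longlongrightarrow> 0) (at 0)"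
    by simp
  moreover have "\<bar>\<bar>h\<bar> powr b / h\<bar> = \<bar>h\<bar> powr (b - 1)" if "h \<noteq> 0" for h :: real
    using that by (simp add: powr_diff abs_divide)
  then have "\<forall>\<^sub>F h in at (0::real). \<bar>h\<bar> powr (b - 1) = \<bar>\<bar>h\<bar> powr b / h\<bar>"
    by (auto simp: eventually_at intro: exI[of _ 1])
  ultimately have "((\<lambda>h::real. \<bar>\<bar>h\<bar> powr b / h\<bar>) \<longlongrightarrow> 0) (at 0)"
    by (rule Lim_transform_eventually)
  then have "((\<lambda>h::real. \<bar>h\<bar> powr b / h) \<longlongrightarrow> 0) (at 0)"
    by (rule tendsto_rabs_zero_cancel)
  then show ?thesis
    using equal assms by (simp add: DERIV_def)
next
  case greater
  have "((\<lambda>x. x powr b) has_real_derivative b * x powr (b - 1)) (at x)"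
    using greater by (auto intro!: derivative_eq_intros)
  then have "((\<lambda>x. \<bar>x\<bar> powr b) has_real_derivative b * x powr (b - 1)) (at x)"
    by (rule has_field_derivative_transform_within_open[of _ _ _ "{0<..}"]) (use greater in auto)
  then show ?thesis using greater by simp
next
  case less
  have "((\<lambda>x. (- x) powr b) has_real_derivative - (b * (- x) powr (b - 1))) (at x)"
    using less by (auto intro!: derivative_eq_intros)
  then have "((\<lambda>x. \<bar>x\<bar> powr b) has_real_derivative - (b * (- x) powr (b - 1))) (at x)"
    by (rule has_field_derivative_transform_within_open[of _ _ _ "{..<0}"]) (use less in auto)
  then show ?thesis using less by simp
qed

text \<open>Otherwise \<open>\<bar>f\<bar>\<close> would exceed its essential supremum on a whole
  interval ending at \<open>z\<close>, a set of positive measure. This gives lower bounds for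
  derivatives that jump at \<open>z\<close>.\<close>

lemma le_ess_sup_norm:
  assumes "(f \<longlongrightarrow> L) (at_left z)"
  shows "ereal \<bar>L\<bar> \<le> ess_sup_norm f"
proof (rule ccontr)
  assume "\<not> ereal \<bar>L\<bar> \<le> ess_sup_norm f"
  moreover have "((\<lambda>x. ereal \<bar>f x\<bar>) \<longlongrightarrow> ereal \<bar>L\<bar>) (at_left z)"
    by (intro tendsto_intros assms)
  ultimately have "\<forall>\<^sub>F x in at_left z. ess_sup_norm f < ereal \<bar>f x\<bar>"
    by (intro order_tendstoD(1)) auto
  then obtain b where b: "b < z" "\<And>x. b < x \<Longrightarrow> x < z \<Longrightarrow> ess_sup_norm f < ereal \<bar>f x\<bar>"
    by (auto simp: eventually_at_left_field)
  have "AE x in lborel. ereal \<bar>f x\<bar> \<le> ess_sup_norm f"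
    unfolding ess_sup_norm_def by (rule esssup_AE)
  then have "AE x in lborel. x \<notin> {b<..<z}"
    by eventually_elim (use b(2) in \<open>force simp: not_less[symmetric]\<close>)
  then have "{b<..<z} \<in> null_sets lborel"
    by (subst AE_iff_null_sets) auto
  then show False
    using b(1) by (simp add: null_sets_def)
qed

lemma ess_sup_norm_le:
  assumes "f \<in> borel_measurable borel" and "\<And>x. x \<noteq> z \<Longrightarrow> \<bar>f x\<bar> \<le> B"
  shows "ess_sup_norm f \<le> ereal B"
  unfolding ess_sup_norm_def
proof (rule esssup_I)
  show "(\<lambda>x. ereal \<bar>f x\<bar>) \<in> borel_measurable lborel"
    using assms(1) by simp
  show "AE x in lborel. ereal \<bar>f x\<bar> \<le> ereal B"
    using AE_lborel_singleton[of z] by eventually_elim (use assms(2) in auto)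
qed

section \<open>The regularized incomplete Gamma function\<close>

text \<open>The density of the Gamma law with shape \<open>a\<close> and rate 1; this is the
  \<open>q\<close> of the overview.\<close>

definition reg_Gamma_density :: "real \<Rightarrow> real \<Rightarrow> real" where
  "reg_Gamma_density a u = u powr (a - 1) * exp (- u) / Gamma a"

lemma reg_Gamma_density_pos:
  assumes "0 < a" "0 < u"
  shows "0 < reg_Gamma_density a u"
  using assms Gamma_real_pos[of a] by (simp add: reg_Gamma_density_def)

lemma has_integral_Gamma_exp_minus:
  fixes a :: real
  assumes "0 < a"
  shows "((\<lambda>t. t powr (a - 1) * exp (- t)) has_integral Gamma a) {0..}"
  using Gamma_integral_real[OF assms] by (simp add: exp_minus field_simps)

lemma lower_inc_Gamma_integrable:
  fixes a u :: real
  assumes "0 < a"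
  shows "(\<lambda>t. t powr (a - 1) * exp (- t)) integrable_on {0..u}"
  using has_integral_Gamma_exp_minus[OF assms]
  by (intro integrable_on_subinterval[of _ "{0..}"]) auto

lemma reg_Gamma_0 [simp]: "reg_Gamma a 0 = 0"
  by (simp add: reg_Gamma_def lower_inc_Gamma_def)

text \<open>The integrand is singular at 0 for \<open>a < 1\<close>, so the fundamental theorem is
  used in the form that asks for continuity at \<open>u\<close> only. Integrating up to
  \<open>u + 1\<close> makes \<open>u\<close> an interior point.\<close>

lemma DERIV_reg_Gamma:
  assumes "0 < a" "0 < u"
  shows "(reg_Gamma a has_real_derivative reg_Gamma_density a u) (at u)"
proof -
  let ?q = "\<lambda>t::real. t powr (a - 1) * exp (- t)"
  have "continuous (at u) ?q"
    using assms by (auto intro!: continuous_intros)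
  then have "continuous (at u within ({0..u + 1} - {})) ?q"
    using continuous_at_imp_continuous_at_within by blast
  then have "(lower_inc_Gamma a has_vector_derivative ?q u) (at u within ({0..u + 1} - {}))"
    using assms integral_has_vector_derivative_continuous_at
            [OF lower_inc_Gamma_integrable[OF assms(1), of "u + 1"], of u "{}"]
    unfolding lower_inc_Gamma_def[abs_def] by auto
  then have "(lower_inc_Gamma a has_real_derivative ?q u) (at u within {0..u + 1})"
    by (simp add: has_real_derivative_iff_has_vector_derivative)
  moreover have "at u within {0..u + 1} = at u"
    using assms by (intro at_within_interior) (simp add: interior_atLeastAtMost_real)
  ultimately have "(lower_inc_Gamma a has_real_derivative ?q u) (at u)"
    by simp
  then show ?thesis
    unfolding reg_Gamma_def[abs_def] reg_Gamma_density_def by (rule DERIV_cdivide)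
qed

lemmas DERIV_reg_Gamma' [derivative_intros] = DERIV_chain2[OF DERIV_reg_Gamma]

lemma continuous_on_reg_Gamma:
  assumes "0 < a"
  shows "continuous_on {0..} (reg_Gamma a)"
proof -
  have "continuous_on {0..b} (reg_Gamma a)" for b
    using indefinite_integral_continuous_1[OF lower_inc_Gamma_integrable[OF assms, of b]]
      Gamma_real_pos[OF assms]
    unfolding reg_Gamma_def[abs_def] lower_inc_Gamma_def[abs_def]
    by (intro continuous_on_divide) auto
  then have "continuous (at x within {0..}) (reg_Gamma a)" if "0 \<le> x" for x
  proof -
    have "continuous (at x within {0..x + 1}) (reg_Gamma a)"
      using \<open>\<And>b. continuous_on {0..b} (reg_Gamma a)\<close>[of "x + 1"] that
      by (auto simp: continuous_on_eq_continuous_within)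
    moreover have "at x within {0..x + 1} = at x within {0..}"
      by (rule at_within_nhd[of x "{..<x + 1}"]) auto
    ultimately show ?thesis by simp
  qed
  then show ?thesis
    by (auto simp: continuous_on_eq_continuous_within)
qed

lemma continuous_on_subset_reg_Gamma:
  assumes "0 < a" "A \<subseteq> {0..}"
  shows "continuous_on A (reg_Gamma a)"
  using continuous_on_subset[OF continuous_on_reg_Gamma] assms by blast

lemma tendsto_reg_Gamma_0:
  assumes "0 < a"
  shows "(reg_Gamma a \<longlongrightarrow> 0) (at_right 0)"
proof -
  have "(reg_Gamma a \<longlongrightarrow> 0) (at 0 within {0..})"
    using continuous_on_reg_Gamma[OF assms] by (force simp: continuous_on)
  then show ?thesis
    by (rule tendsto_within_subset) auto
qed

text \<open>A nonnegative integrand makes the Gamma integral a Lebesgue integral, which is the limit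
  of the integrals over \<open>{0..b}\<close>.\<close>

lemma tendsto_reg_Gamma_at_top:
  assumes "0 < a"
  shows "(reg_Gamma a \<longlongrightarrow> 1) at_top"
proof -
  let ?q = "\<lambda>t::real. t powr (a - 1) * exp (- t)"
  have int: "set_integrable lebesgue {0..} ?q"
    using has_integral_Gamma_exp_minus[OF assms]
    by (intro nonnegative_absolutely_integrable_1) auto
  have "((\<lambda>b. set_lebesgue_integral lebesgue {0..b} ?q)
      \<longlongrightarrow> set_lebesgue_integral lebesgue {0..} ?q) at_top"
    by (intro tendsto_set_lebesgue_integral_at_top int) auto
  moreover have "set_lebesgue_integral lebesgue {0..} ?q = Gamma a"
    using set_lebesgue_integral_eq_integral(2)[OF int] has_integral_Gamma_exp_minus[OF assms]
    by (simp add: integral_unique)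
  moreover have "set_lebesgue_integral lebesgue {0..b} ?q = lower_inc_Gamma a b" for b
  proof -
    have "set_integrable lebesgue {0..b} ?q"
      by (rule set_integrable_subset[OF int]) auto
    then show ?thesis
      using set_lebesgue_integral_eq_integral(2) by (auto simp: lower_inc_Gamma_def)
  qed
  ultimately have "(lower_inc_Gamma a \<longlongrightarrow> Gamma a) at_top"
    by simp
  from tendsto_divide[OF this tendsto_const[of "Gamma a"]] show ?thesis
    using Gamma_real_pos[OF assms] by (simp add: reg_Gamma_def[abs_def])
qed

lemma reg_Gamma_strict_mono:
  assumes "0 < a" "0 \<le> u" "u < v"
  shows "reg_Gamma a u < reg_Gamma a v"
proof (rule DERIV_pos_imp_increasing_open[OF assms(3)])
  show "\<exists>y. DERIV (reg_Gamma a) x :> y \<and> y > 0" if "u < x" "x < v" for x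
    using DERIV_reg_Gamma[of a x] reg_Gamma_density_pos[of a x] assms that by auto
  show "continuous_on {u..v} (reg_Gamma a)"
    using assms by (intro continuous_on_subset_reg_Gamma) auto
qed

lemma reg_Gamma_pos: "0 < a \<Longrightarrow> 0 < u \<Longrightarrow> 0 < reg_Gamma a u"
  using reg_Gamma_strict_mono[of a 0 u] by simp

lemma reg_Gamma_nonneg: "0 < a \<Longrightarrow> 0 \<le> u \<Longrightarrow> 0 \<le> reg_Gamma a u"
  using reg_Gamma_pos[of a u] by (cases "u = 0") auto

lemma reg_Gamma_less_1:
  assumes "0 < a" "0 \<le> u"
  shows "reg_Gamma a u < 1"
proof (cases "u = 0")
  case False
  have "- 1 < - reg_Gamma a u"
  proof (rule DERIV_neg_imp_decreasing_at_top[where f = "\<lambda>u. - reg_Gamma a u"])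
    show "\<exists>y. DERIV (\<lambda>u. - reg_Gamma a u) x :> y \<and> y < 0" if "u \<le> x" for x
      using DERIV_minus[OF DERIV_reg_Gamma[of a x]] reg_Gamma_density_pos[of a x] assms False that
      by (intro exI[of _ "- reg_Gamma_density a x"]) auto
    show "((\<lambda>u. - reg_Gamma a u) \<longlongrightarrow> - 1) at_top"
      by (intro tendsto_intros tendsto_reg_Gamma_at_top assms)
  qed
  then show ?thesis by simp
qed auto

text \<open>Comes from bounding \<open>exp (- t)\<close> by 1 in the integrand. It measures how fast
  \<open>reg_Gamma\<close> vanishes at 0, to be played off against the singularity of its
  density.\<close>

lemma reg_Gamma_le_powr:
  assumes "0 < a" "0 < u"
  shows "reg_Gamma a u \<le> u powr a / (a * Gamma a)"
proof -
  let ?f = "\<lambda>u. u powr a / (a * Gamma a) - reg_Gamma a u"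
  have "?f 0 \<le> ?f u"
  proof (rule DERIV_nonneg_imp_increasing_open[where f = ?f])
    have "continuous_on {0..u} (\<lambda>u. u powr a)"
      using assms by (intro continuous_on_powr' continuous_intros) auto
    moreover have "Gamma a \<noteq> 0"
      using Gamma_real_pos[OF assms(1)] by simp
    ultimately show "continuous_on {0..u} ?f"
      using assms
      by (intro continuous_on_diff continuous_on_divide continuous_on_const
          continuous_on_subset_reg_Gamma) auto
    show "\<exists>y. DERIV ?f x :> y \<and> y \<ge> 0" if "0 < x" "x < u" for x
    proof (intro exI conjI)
      show "DERIV ?f x :> x powr (a - 1) / Gamma a - reg_Gamma_density a x"
        using that assms less_imp_neq[OF Gamma_real_pos[OF assms(1)]]
        by (auto intro!: derivative_eq_intros)
      have "x powr (a - 1) * exp (- x) \<le> x powr (a - 1) * 1"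
        using that by (intro mult_left_mono) auto
      then show "x powr (a - 1) / Gamma a - reg_Gamma_density a x \<ge> 0"
        using Gamma_real_pos[of a] assms by (simp add: reg_Gamma_density_def divide_right_mono)
    qed
  qed (use assms in simp)
  then show ?thesis using assms by simp
qed

section \<open>Derivative and boundary limits of the Gamma density\<close>

lemma DERIV_reg_Gamma_density:
  assumes "0 < u"
  shows "(reg_Gamma_density a has_real_derivative
    reg_Gamma_density a u * ((a - 1) / u - 1)) (at u)"
proof -
  have "u powr (a - 1 - 1) = u powr (a - 1) / u"
    using powr_diff[of u "a - 1" 1] assms by simp
  moreover have "((\<lambda>u. u powr (a - 1) * exp (- u)) has_real_derivative
      (a - 1) * u powr (a - 1 - 1) * exp (- u) - u powr (a - 1) * exp (- u)) (at u)"
    using assms by (auto intro!: derivative_eq_intros)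
  ultimately have "((\<lambda>u. u powr (a - 1) * exp (- u)) has_real_derivative
      u powr (a - 1) * exp (- u) * ((a - 1) / u - 1)) (at u)"
    by (simp add: algebra_simps)
  from DERIV_cdivide[OF this, of "Gamma a"] show ?thesis
    by (simp add: reg_Gamma_density_def[abs_def])
qed

lemmas DERIV_reg_Gamma_density' [derivative_intros] = DERIV_chain2[OF DERIV_reg_Gamma_density]

lemma tendsto_reg_Gamma_density_at_top: "(reg_Gamma_density a \<longlongrightarrow> 0) at_top"
proof -
  have "((\<lambda>u::real. u powr (a - 1) * exp (- u)) \<longlongrightarrow> 0) at_top"
    by real_asymp
  then show ?thesis
    unfolding reg_Gamma_density_def[abs_def] by (rule tendsto_divide_zero)
qed

lemma tendsto_times_reg_Gamma_density_0:
  assumes "0 < a"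
  shows "((\<lambda>u. u * reg_Gamma_density a u) \<longlongrightarrow> 0) (at_right 0)"
proof -
  have "((\<lambda>u::real. u * (u powr (a - 1) * exp (- u))) \<longlongrightarrow> 0) (at_right 0)"
    using assms by real_asymp
  from tendsto_divide_zero[OF this, of "Gamma a"] show ?thesis
    by (simp add: reg_Gamma_density_def[abs_def])
qed

lemma tendsto_times_reg_Gamma_density_at_top:
  "((\<lambda>u. u * reg_Gamma_density a u) \<longlongrightarrow> 0) at_top"
proof -
  have "((\<lambda>u::real. u * (u powr (a - 1) * exp (- u))) \<longlongrightarrow> 0) at_top"
    by real_asymp
  from tendsto_divide_zero[OF this, of "Gamma a"] show ?thesis
    by (simp add: reg_Gamma_density_def[abs_def])
qed

text \<open>The factors are of order \<open>u powr a\<close> and \<open>u powr (a - 1)\<close>, so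
  the product is of order \<open>u powr (2 * a - 1)\<close>; this is where \<open>a > 1/2\<close>
  enters.\<close>

lemma tendsto_reg_Gamma_times_density_0:
  assumes "1 / 2 < a"
  shows "((\<lambda>u. reg_Gamma a u * reg_Gamma_density a u) \<longlongrightarrow> 0) (at_right 0)"
proof (rule tendsto_sandwich[where f = "\<lambda>_. 0"
        and h = "\<lambda>u. u powr a / (a * Gamma a) * reg_Gamma_density a u"])
  show "((\<lambda>u. u powr a / (a * Gamma a) * reg_Gamma_density a u) \<longlongrightarrow> 0) (at_right 0)"
  proof -
    have "((\<lambda>u::real. u powr a * (u powr (a - 1) * exp (- u))) \<longlongrightarrow> 0) (at_right 0)"
      using assms by real_asymp
    from tendsto_divide_zero[OF this, of "a * Gamma a * Gamma a"] show ?thesis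
      by (simp add: reg_Gamma_density_def[abs_def])
  qed
  have pos: "\<forall>\<^sub>F u in at_right 0. (0::real) < u"
    by (simp add: eventually_at_right_less)
  show "\<forall>\<^sub>F u in at_right 0. 0 \<le> reg_Gamma a u * reg_Gamma_density a u"
    using pos assms reg_Gamma_pos[of a] reg_Gamma_density_pos[of a]
    by (auto elim!: eventually_mono intro: less_imp_le)
  show "\<forall>\<^sub>F u in at_right 0. reg_Gamma a u * reg_Gamma_density a u
      \<le> u powr a / (a * Gamma a) * reg_Gamma_density a u"
    using pos
  proof eventually_elim
    case (elim u)
    then show ?case
      using assms reg_Gamma_le_powr[of a u] reg_Gamma_density_pos[of a u]
      by (intro mult_right_mono) auto
  qed
qed auto

section \<open>Two-sided bounds for the Gamma tail\<close>

lemma reg_Gamma_upper_tail_le: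
  assumes "0 < a" "a < 1" "0 < u"
  shows "1 - reg_Gamma a u \<le> reg_Gamma_density a u"
proof -
  \<comment> \<open>The derivative of this difference keeps only the term with
    \<open>(a - 1) / x\<close>, negative since \<open>a < 1\<close>. A strictly decreasing function
    with limit 0 at infinity is positive.\<close>
  let ?f = "\<lambda>u. reg_Gamma_density a u - (1 - reg_Gamma a u)"
  have "0 < ?f u"
  proof (rule DERIV_neg_imp_decreasing_at_top[where f = ?f])
    show "\<exists>y. DERIV ?f x :> y \<and> y < 0" if "u \<le> x" for x
    proof (intro exI conjI)
      show "DERIV ?f x :> reg_Gamma_density a x * ((a - 1) / x)"
        using assms that by (auto intro!: derivative_eq_intros simp: algebra_simps)
      show "reg_Gamma_density a x * ((a - 1) / x) < 0"
        using assms that reg_Gamma_density_pos[of a x]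
        by (intro mult_pos_neg) (auto simp: divide_neg_pos)
    qed
    show "(?f \<longlongrightarrow> 0) at_top"
      using assms by (auto intro!: tendsto_eq_intros tendsto_reg_Gamma_at_top
          tendsto_reg_Gamma_density_at_top)
  qed
  then show ?thesis by simp
qed

text \<open>Same method with one more term of the asymptotic expansion of the tail: the difference
  of the two sides again decreases strictly to 0.\<close>

lemma reg_Gamma_upper_tail_ge:
  assumes "0 < a" "a < 1" "0 < u"
  shows "reg_Gamma_density a u * (1 - (1 - a) / u) \<le> 1 - reg_Gamma a u"
proof -
  let ?f = "\<lambda>u. (1 - reg_Gamma a u) - reg_Gamma_density a u * (1 - (1 - a) / u)"
  have "0 < ?f u"
  proof (rule DERIV_neg_imp_decreasing_at_top[where f = ?f])
    show "\<exists>y. DERIV ?f x :> y \<and> y < 0" if "u \<le> x" for x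
    proof (intro exI conjI)
      have x: "0 < x" using assms that by simp
      have "- reg_Gamma_density a x - (reg_Gamma_density a x * ((a - 1) / x - 1) * (1 - (1 - a) / x)
          + reg_Gamma_density a x * ((1 - a) / x\<^sup>2))
        = - (reg_Gamma_density a x * ((1 - a) * (2 - a) / x\<^sup>2))"
        using x by (simp add: field_simps power2_eq_square)
      moreover have "DERIV ?f x :> - reg_Gamma_density a x
          - (reg_Gamma_density a x * ((a - 1) / x - 1) * (1 - (1 - a) / x)
          + reg_Gamma_density a x * ((1 - a) / x\<^sup>2))"
        using assms x
        by (auto intro!: derivative_eq_intros simp: field_simps power2_eq_square)
      ultimately show "DERIV ?f x :> - (reg_Gamma_density a x * ((1 - a) * (2 - a) / x\<^sup>2))"
        by simp
      show "- (reg_Gamma_density a x * ((1 - a) * (2 - a) / x\<^sup>2)) < 0"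
        using assms that reg_Gamma_density_pos[of a x] by simp
    qed
    have "((\<lambda>u. 1 - (1 - a) / u) \<longlongrightarrow> 1) at_top"
      by real_asymp
    with assms(1) have "(?f \<longlongrightarrow> (1 - 1) - 0 * 1) at_top"
      by (intro tendsto_intros tendsto_reg_Gamma_at_top tendsto_reg_Gamma_density_at_top)
    then show "(?f \<longlongrightarrow> 0) at_top"
      by simp
  qed
  then show ?thesis by simp
qed

section \<open>The critical equation\<close>

text \<open>The \<open>D\<close> of the overview: right side minus left side of the critical
  equation, with the explicit density in place of \<open>deriv\<close>.\<close>

definition crit_fun :: "real \<Rightarrow> real \<Rightarrow> real" where
  "crit_fun a u = 1 - (reg_Gamma a u)\<^sup>2 - 2 * reg_Gamma a u * reg_Gamma_density a u"

lemma crit_eq_iff: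
  assumes "0 < a" "0 < u"
  shows "crit_eq a u \<longleftrightarrow> crit_fun a u = 0"
  using DERIV_imp_deriv[OF DERIV_reg_Gamma[OF assms]] by (auto simp: crit_eq_def crit_fun_def)

text \<open>Locates the single sign change of the overview's \<open>E\<close>; at this point
  \<open>e\<close> the function \<open>crit_fun\<close> turns from decreasing to increasing.\<close>

lemma reg_Gamma_balance_sign:
  fixes a :: real
  assumes "1 / 2 < a" "a < 1"
  obtains e where "0 < e"
    "\<And>u. 0 < u \<Longrightarrow> u < e \<Longrightarrow> (1 - a) * reg_Gamma a u < u * reg_Gamma_density a u"
    "\<And>u. e < u \<Longrightarrow> u * reg_Gamma_density a u < (1 - a) * reg_Gamma a u"
proof -
  define E where "E = (\<lambda>u. u * reg_Gamma_density a u - (1 - a) * reg_Gamma a u)"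
  \<comment> \<open>The zero of the derivative of \<open>E\<close>, hence its peak; it is positive
    because \<open>a > 1/2\<close>.\<close>
  define m where "m = 2 * a - 1"
  have m: "0 < m" using assms by (simp add: m_def)
  have der: "DERIV E u :> reg_Gamma_density a u * (m - u)" if "0 < u" for u
    unfolding E_def m_def using assms that
    by (auto intro!: derivative_eq_intros simp: field_simps)
  have "(reg_Gamma a \<longlongrightarrow> 0) (at_right 0)"
    using assms by (intro tendsto_reg_Gamma_0) auto
  then have "(E \<longlongrightarrow> 0 - (1 - a) * 0) (at_right 0)"
    unfolding E_def using assms
    by (intro tendsto_intros tendsto_times_reg_Gamma_density_0) auto
  then have cont: "continuous_on A E" if "A \<subseteq> {0..}" for A
    using DERIV_isCont[OF der] that
    by (intro continuous_on_nonneg_realI) (auto simp: E_def)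
  have E0: "E 0 = 0" by (simp add: E_def)
  have up: "0 < E u" if "0 < u" "u \<le> m" for u
  proof -
    have "E 0 < E u"
    proof (rule DERIV_pos_imp_increasing_open[OF that(1)])
      show "\<exists>y. DERIV E x :> y \<and> y > 0" if "0 < x" "x < u" for x
        using der[of x] reg_Gamma_density_pos[of a x] that \<open>u \<le> m\<close> assms by force
    qed (auto intro!: cont)
    then show ?thesis by (simp add: E0)
  qed
  have down: "E v < E u" if "m \<le> u" "u < v" for u v
  proof (rule DERIV_neg_imp_decreasing_open[OF that(2)])
    show "\<exists>y. DERIV E x :> y \<and> y < 0" if "u < x" "x < v" for x
      using der[of x] reg_Gamma_density_pos[of a x] that \<open>m \<le> u\<close> m assms
      by (intro exI[of _ "reg_Gamma_density a x * (m - x)"]) (auto intro: mult_pos_neg)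
  qed (use that m in \<open>auto intro!: cont\<close>)
  have "(reg_Gamma a \<longlongrightarrow> 1) at_top"
    using assms by (intro tendsto_reg_Gamma_at_top) auto
  then have "(E \<longlongrightarrow> 0 - (1 - a) * 1) at_top"
    unfolding E_def using assms by (intro tendsto_intros tendsto_times_reg_Gamma_density_at_top)
  then have "\<forall>\<^sub>F u in at_top. E u < 0"
    using assms by (intro order_tendstoD(2)) auto
  then have "\<forall>\<^sub>F u in at_top. m < u \<and> E u < 0"
    by (intro eventually_conj eventually_gt_at_top)
  then obtain v where v: "m < v" "E v < 0"
    by (auto dest: eventually_happens)
  \<comment> \<open>\<open>E\<close> is positive at its peak \<open>m\<close> and negative at
    \<open>v\<close>; since it decreases strictly beyond \<open>m\<close>, the crossing found here
    is the only positive zero.\<close>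
  have "\<exists>e\<ge>m. e \<le> v \<and> E e = 0"
    using v up[of m] m by (intro IVT2') (auto intro!: cont)
  then obtain e where e: "m \<le> e" "E e = 0" by auto
  show thesis
  proof
    show "0 < e" using e m by simp
    show "(1 - a) * reg_Gamma a u < u * reg_Gamma_density a u" if "0 < u" "u < e" for u
      using up[of u] down[of u e] e that by (cases "u \<le> m") (auto simp: E_def)
    show "u * reg_Gamma_density a u < (1 - a) * reg_Gamma a u" if "e < u" for u
      using down[of e u] e that by (auto simp: E_def)
  qed
qed

text \<open>\<open>crit_fun\<close> starts at 1, falls until \<open>e\<close> and then rises towards
  its limit 0. It is therefore negative from \<open>e\<close> on and crosses zero once, before
  \<open>e\<close>.\<close>

lemma crit_fun_sign:
  fixes a :: real
  assumes "1 / 2 < a" "a < 1"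
  obtains c where "0 < c" "crit_fun a c = 0"
    "\<And>u. 0 < u \<Longrightarrow> u < c \<Longrightarrow> 0 < crit_fun a u"
    "\<And>u. c < u \<Longrightarrow> crit_fun a u < 0"
proof -
  let ?D = "crit_fun a"
  obtain e where e: "0 < e"
    "\<And>u. 0 < u \<Longrightarrow> u < e \<Longrightarrow> (1 - a) * reg_Gamma a u < u * reg_Gamma_density a u"
    "\<And>u. e < u \<Longrightarrow> u * reg_Gamma_density a u < (1 - a) * reg_Gamma a u"
    using reg_Gamma_balance_sign[OF assms] by blast
  have der: "DERIV ?D u :> - (2 * reg_Gamma_density a u / u
      * (u * reg_Gamma_density a u - (1 - a) * reg_Gamma a u))" if "0 < u" for u
    unfolding crit_fun_def[abs_def] using assms that
    by (auto intro!: derivative_eq_intros simp: field_simps power2_eq_square)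
  have "(reg_Gamma a \<longlongrightarrow> 0) (at_right 0)"
    using assms by (intro tendsto_reg_Gamma_0) auto
  \<comment> \<open>The product is bracketed because the density alone has no finite limit at
    0.\<close>
  then have "((\<lambda>u. 1 - (reg_Gamma a u)\<^sup>2 - 2 * (reg_Gamma a u * reg_Gamma_density a u))
      \<longlongrightarrow> 1 - 0\<^sup>2 - 2 * 0) (at_right 0)"
    using assms by (intro tendsto_intros tendsto_reg_Gamma_times_density_0) auto
  then have "(?D \<longlongrightarrow> ?D 0) (at_right 0)"
    by (simp add: crit_fun_def[abs_def] mult.assoc)
  then have cont: "continuous_on A ?D" if "A \<subseteq> {0..}" for A
    using DERIV_isCont[OF der] that by (intro continuous_on_nonneg_realI) auto
  have down: "?D v < ?D u" if "0 \<le> u" "u < v" "v \<le> e" for u v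
  proof (rule DERIV_neg_imp_decreasing_open[OF that(2)])
    show "\<exists>y. DERIV ?D x :> y \<and> y < 0" if "u < x" "x < v" for x
      using reg_Gamma_density_pos[of a x] e(2)[of x] that \<open>0 \<le> u\<close> \<open>v \<le> e\<close> assms
      by (rule_tac exI, rule_tac conjI, rule_tac der) auto
  qed (use that in \<open>auto intro!: cont\<close>)
  have up: "?D u < ?D v" if "e \<le> u" "u < v" for u v
  proof (rule DERIV_pos_imp_increasing_open[OF that(2)])
    show "\<exists>y. DERIV ?D x :> y \<and> y > 0" if "u < x" "x < v" for x
      using reg_Gamma_density_pos[of a x] e(3)[of x] e(1) that \<open>e \<le> u\<close> assms
      by (rule_tac exI, rule_tac conjI, rule_tac der) (auto intro!: mult_pos_neg divide_neg_pos simp: mult_less_0_iff divide_less_0_iff)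
  qed (use that e(1) in \<open>auto intro!: cont\<close>)
  have "(reg_Gamma a \<longlongrightarrow> 1) at_top"
    using assms by (intro tendsto_reg_Gamma_at_top) auto
  then have "(?D \<longlongrightarrow> 1 - 1\<^sup>2 - 2 * 1 * 0) at_top"
    unfolding crit_fun_def[abs_def]
    by (intro tendsto_intros tendsto_reg_Gamma_density_at_top)
  then have lim: "(?D \<longlongrightarrow> 0) at_top" by simp
  have neg: "?D u < 0" if "e \<le> u" for u
  proof -
    \<comment> \<open>Comparison with the limit gives only a weak inequality at
      \<open>u + 1\<close>; strict growth from \<open>u\<close> to \<open>u + 1\<close> then makes
      it strict at \<open>u\<close>.\<close>
    have "\<forall>\<^sub>F v in at_top. ?D (u + 1) \<le> ?D v"
      using eventually_gt_at_top[of "u + 1"]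
      by eventually_elim (use up[of "u + 1"] that in \<open>auto intro: less_imp_le\<close>)
    then have "?D (u + 1) \<le> 0"
      using tendsto_lowerbound[OF lim] by simp
    then show ?thesis using up[of u "u + 1"] that by simp
  qed
  have D0: "?D 0 = 1" by (simp add: crit_fun_def)
  have "\<exists>c\<ge>0. c \<le> e \<and> ?D c = 0"
    using neg[of e] D0 e(1) by (intro IVT2') (auto intro!: cont)
  then obtain c where c: "0 \<le> c" "c \<le> e" "?D c = 0" by auto
  show thesis
  proof
    show "0 < c" using c D0 by (cases "c = 0") auto
    show "0 < ?D u" if "0 < u" "u < c" for u
      using down[of u c] c that by simp
    show "?D u < 0" if "c < u" for u
      using down[of c u] neg[of u] c that by (cases "u \<le> e") auto
  qed (rule c)
qed

lemma crit_unique: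
  fixes a :: real
  assumes "1 / 2 < a" "a < 1"
  shows "\<exists>!u. 0 < u \<and> crit_eq a u"
proof -
  obtain c where c: "0 < c" "crit_fun a c = 0"
    "\<And>u. 0 < u \<Longrightarrow> u < c \<Longrightarrow> 0 < crit_fun a u"
    "\<And>u. c < u \<Longrightarrow> crit_fun a u < 0"
    using crit_fun_sign[OF assms] by blast
  show ?thesis
  proof (rule ex1I[of _ c])
    show "0 < c \<and> crit_eq a c"
      using c assms by (simp add: crit_eq_iff)
    show "u = c" if "0 < u \<and> crit_eq a u" for u
      using c(3)[of u] c(4)[of u] that assms crit_eq_iff[of a u]
      by (cases u c rule: linorder_cases) auto
  qed
qed

text \<open>The derivative of the profile is \<open>exp u * crit_fun a u\<close>, so the profile
  rises strictly up to the zero of \<open>crit_fun\<close> and falls strictly after it. Uniqueness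
  identifies that zero with the given \<open>c\<close>.\<close>

lemma reg_Gamma_profile_less_max:
  fixes a u c :: real
  assumes "1 / 2 < a" "a < 1" "0 < c" "crit_eq a c" "0 \<le> u" "u \<noteq> c"
  shows "exp u * (1 - (reg_Gamma a u)\<^sup>2) < exp c * (1 - (reg_Gamma a c)\<^sup>2)"
proof -
  let ?h = "\<lambda>u. exp u * (1 - (reg_Gamma a u)\<^sup>2)"
  obtain c' where c': "0 < c'" "crit_fun a c' = 0"
    "\<And>u. 0 < u \<Longrightarrow> u < c' \<Longrightarrow> 0 < crit_fun a u"
    "\<And>u. c' < u \<Longrightarrow> crit_fun a u < 0"
    using crit_fun_sign[OF assms(1,2)] by blast
  have "crit_eq a c'" using c' assms by (simp add: crit_eq_iff)
  then have [simp]: "c' = c"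
    using crit_unique[OF assms(1,2)] assms c'(1) by auto
  have der: "DERIV ?h x :> exp x * crit_fun a x" if "0 < x" for x
    unfolding crit_fun_def using assms that
    by (auto intro!: derivative_eq_intros simp: algebra_simps)
  have cont: "continuous_on A ?h" if "A \<subseteq> {0..}" for A
    using that assms by (intro continuous_intros continuous_on_subset_reg_Gamma) auto
  show ?thesis
  proof (cases "u < c")
    case True
    show ?thesis
    proof (rule DERIV_pos_imp_increasing_open[OF True, of ?h])
      show "\<exists>y. DERIV ?h x :> y \<and> y > 0" if "u < x" "x < c" for x
        using c'(3)[of x] that assms
        by (rule_tac exI, rule_tac conjI, rule_tac der) auto
    qed (use assms in \<open>auto intro!: cont\<close>)
  next
    case False
    then have "c < u" using assms by simp
    then show ?thesis
    proof (rule DERIV_neg_imp_decreasing_open[of _ _ ?h])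
      show "\<exists>y. DERIV ?h x :> y \<and> y < 0" if "c < x" "x < u" for x
        using c'(4)[of x] that assms
        by (rule_tac exI, rule_tac conjI, rule_tac der) (auto intro: mult_pos_neg)
    qed (use assms in \<open>auto intro!: cont\<close>)
  qed
qed

section \<open>The generalized Gaussian distribution\<close>

text \<open>The abbreviation \<open>scaled\<close> is the change of variable to \<open>u\<close>:
  for \<open>X\<close> with density \<open>p\<close>, \<open>scaled X\<close> follows the Gamma law
  with shape \<open>a\<close> and rate 1.\<close>

locale gen_gauss =
  fixes \<beta> lam a :: real
  assumes beta: "1 < \<beta>" "\<beta> < 2" and lam: "0 < lam" and a_def: "a = 1 / \<beta>"
begin

abbreviation "p \<equiv> gg_density \<beta> lam"
abbreviation "F \<equiv> gg_cdf \<beta> lam"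
abbreviation "g \<equiv> stein_g \<beta> lam"
abbreviation "S \<equiv> stein_sol \<beta> lam"
abbreviation "scaled x \<equiv> lam * \<bar>x\<bar> powr \<beta>"

lemma a_bounds: "1 / 2 < a" "a < 1" "0 < a" and beta_a: "\<beta> * a = 1"
  using beta by (auto simp: a_def field_simps)

lemma scaled_pos: "x \<noteq> 0 \<Longrightarrow> 0 < scaled x"
  using lam by simp

lemma scaled_nonneg: "0 \<le> scaled x"
  using lam by simp

lemma density_pos: "0 < p x"
  using beta lam Gamma_real_pos[of "1 / \<beta>"] by (simp add: gg_density_def)

lemma density_minus [simp]: "p (- x) = p x"
  by (simp add: gg_density_def)

lemma density_eq: "p x = \<beta> * lam powr a / (2 * Gamma a) * exp (- scaled x)"
  by (simp add: gg_density_def a_def)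

lemma stein_g_minus [simp]: "g (- x) = - g x"
  by (simp add: stein_g_def sgn_minus)

lemma stein_g_pos: "0 < x \<Longrightarrow> 0 < g x"
  using beta lam by (simp add: stein_g_def)

lemma stein_g_nonneg: "0 \<le> x \<Longrightarrow> 0 \<le> g x"
  using beta lam by (simp add: stein_g_def)

text \<open>\<open>g\<close> is thus the derivative of the potential and minus the logarithmic
  derivative of \<open>p\<close>. As \<open>\<beta> > 1\<close>, this holds at 0 too.\<close>

lemma DERIV_scaled: "(scaled has_real_derivative g x) (at x)"
  unfolding stein_g_def
  using DERIV_cmult[OF DERIV_abs_powr[OF beta(1)], of lam x] by (simp add: mult_ac)

lemma DERIV_density: "(p has_real_derivative - g x * p x) (at x)"
proof -
  have "((\<lambda>x. \<beta> * lam powr a / (2 * Gamma a) * exp (- scaled x)) has_real_derivative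
      \<beta> * lam powr a / (2 * Gamma a) * (exp (- scaled x) * - g x)) (at x)"
    by (intro DERIV_cmult DERIV_chain2[OF DERIV_exp] DERIV_minus DERIV_scaled)
  then show ?thesis
    by (simp add: density_eq[abs_def] mult_ac)
qed

lemma isCont_density: "isCont p x"
  using DERIV_density DERIV_isCont by blast

lemma isCont_stein_g: "isCont g x"
proof (cases "x = 0")
  case True
  have "((\<lambda>h::real. \<beta> * lam * \<bar>h\<bar> powr (\<beta> - 1)) \<longlongrightarrow> \<beta> * lam * \<bar>0\<bar> powr (\<beta> - 1)) (at 0)"
    using beta by (intro tendsto_powr' tendsto_intros) auto
  then have "((\<lambda>h::real. \<beta> * lam * \<bar>h\<bar> powr (\<beta> - 1)) \<longlongrightarrow> 0) (at 0)"
    by simp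
  moreover have "\<forall>\<^sub>F h in at (0::real). \<beta> * lam * \<bar>h\<bar> powr (\<beta> - 1) = \<bar>g h\<bar>"
    using beta lam
    by (auto simp: eventually_at stein_g_def abs_mult sgn_if intro!: exI[of _ 1])
  ultimately have "((\<lambda>h. \<bar>g h\<bar>) \<longlongrightarrow> 0) (at 0)"
    by (rule Lim_transform_eventually)
  then show ?thesis
    using True tendsto_rabs_zero_cancel[of g] by (simp add: isCont_def) (simp add: stein_g_def)
next
  case False
  then show ?thesis
    unfolding stein_g_def[abs_def] using isCont_sgn[OF continuous_ident, of x]
    by (intro continuous_intros) auto
qed

text \<open>The change of variables formula; the factor 1/2 reflects the two half-lines. The powers
  of \<open>x\<close> cancel because \<open>\<beta> * (a - 1) = 1 - \<beta>\<close>.\<close>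

lemma density_eq_stein_g:
  assumes "0 < x"
  shows "p x = reg_Gamma_density a (scaled x) * g x / 2"
proof -
  have "(lam * x powr \<beta>) powr (a - 1) = lam powr (a - 1) * x powr (1 - \<beta>)"
    using assms lam beta_a by (simp add: powr_mult powr_powr algebra_simps)
  moreover have "x powr (1 - \<beta>) * x powr (\<beta> - 1) = 1"
    using assms by (simp flip: powr_add)
  moreover have "lam powr (a - 1) * lam = lam powr a"
    using lam by (simp add: powr_diff)
  moreover have "reg_Gamma_density a (scaled x) * g x / 2
    = (lam powr (a - 1) * lam) * (x powr (1 - \<beta>) * x powr (\<beta> - 1)) * \<beta> * exp (- scaled x) / (2 * Gamma a)"
    using assms \<open>(lam * x powr \<beta>) powr (a - 1) = lam powr (a - 1) * x powr (1 - \<beta>)\<close>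
    by (simp add: reg_Gamma_density_def stein_g_def mult_ac)
  ultimately show ?thesis
    by (simp add: density_eq mult_ac)
qed

lemma DERIV_reg_Gamma_scaled:
  assumes "0 < x"
  shows "((\<lambda>x. reg_Gamma a (scaled x) / 2) has_real_derivative p x) (at x)"
  using DERIV_cdivide[OF DERIV_chain2[OF DERIV_reg_Gamma[OF a_bounds(3) scaled_pos] DERIV_scaled, of x], of 2]
    assms by (simp only: density_eq_stein_g[OF assms])

section \<open>The distribution function in terms of the incomplete Gamma function\<close>

lemma continuous_on_reg_Gamma_scaled: "continuous_on A (\<lambda>x. reg_Gamma a (scaled x))"
proof (rule continuous_on_compose2[OF continuous_on_reg_Gamma[OF a_bounds(3)]])
  show "continuous_on A scaled"
    using DERIV_isCont[OF DERIV_scaled] by (simp add: continuous_at_imp_continuous_on)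
  show "scaled ` A \<subseteq> {0..}"
    using scaled_nonneg by auto
qed

lemma tendsto_reg_Gamma_scaled_at_top: "((\<lambda>x. reg_Gamma a (scaled x)) \<longlongrightarrow> 1) at_top"
proof (rule filterlim_compose[OF tendsto_reg_Gamma_at_top[OF a_bounds(3)]])
  show "filterlim scaled at_top at_top"
    using beta lam by real_asymp
qed

text \<open>An antiderivative of \<open>p\<close> is built first and its formula and symmetry are
  proved. Its limit at minus infinity then turns out to be 0, which identifies it with the improper
  integral \<open>F\<close>.\<close>

lemma gg_cdf_aux:
  obtains G where "\<And>x. (G has_real_derivative p x) (at x)"
    "\<And>x. F x = G x" "\<And>x. 0 \<le> x \<Longrightarrow> G x = (1 + reg_Gamma a (scaled x)) / 2"
    "\<And>x. G (- x) = 1 - G x"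
proof -
  obtain G0 where G0: "\<And>x. (G0 has_real_derivative p x) (at x)"
    using einterval_antiderivative[of "-\<infinity>" \<infinity> p] isCont_density
    by (auto simp: has_real_derivative_iff_has_vector_derivative)
  \<comment> \<open>The value 1/2 at 0 is the one forced by the symmetry of
    \<open>p\<close>.\<close>
  define G where "G x = G0 x - G0 0 + 1 / 2" for x
  have der: "(G has_real_derivative p x) (at x)" for x
    unfolding G_def by (auto intro!: derivative_eq_intros G0)
  have pos: "G x = (1 + reg_Gamma a (scaled x)) / 2" if "0 \<le> x" for x
  proof (cases "x = 0")
    case False
    let ?k = "\<lambda>x. G x - reg_Gamma a (scaled x) / 2"
    have "?k x = ?k 0"
    proof (rule DERIV_isconst_end[where f = ?k])
      show "0 < x" using that False by simp
      show "continuous_on {0..x} ?k"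
        using DERIV_isCont[OF der]
        by (intro continuous_intros continuous_on_reg_Gamma_scaled)
          (simp_all add: continuous_at_imp_continuous_on)
      show "(?k has_real_derivative 0) (at y)" if "0 < y" "y < x" for y
        using DERIV_diff[OF der DERIV_reg_Gamma_scaled[OF that(1)]] by simp
    qed
    then show ?thesis using beta by (simp add: G_def add_divide_distrib)
  qed (use beta in \<open>simp add: G_def\<close>)
  have refl: "G (- x) = 1 - G x" for x
  proof -
    let ?k = "\<lambda>x. G x + G (- x)"
    have "(?k has_real_derivative 0) (at y)" for y
      using DERIV_add[OF der DERIV_mirror[THEN iffD1, OF der[of "- y"]]] by simp
    then have "?k x = ?k 0"
      by (intro DERIV_isconst_all[where f = ?k]) auto
    then show ?thesis by (simp add: G_def)
  qed
  \<comment> \<open>The limit at minus infinity is read off at plus infinity through the reflection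
    identity.\<close>
  have "((\<lambda>x. (1 - reg_Gamma a (scaled x)) / 2) \<longlongrightarrow> (1 - 1) / 2) at_top"
    by (intro tendsto_intros tendsto_reg_Gamma_scaled_at_top) auto
  moreover have "\<forall>\<^sub>F x in at_top. (1 - reg_Gamma a (scaled x)) / 2 = G (- x)"
    using eventually_ge_at_top[of 0] by eventually_elim (simp add: refl pos field_simps)
  ultimately have "((\<lambda>x. G (- x)) \<longlongrightarrow> 0) at_top"
    using Lim_transform_eventually by fastforce
  then have "(G \<longlongrightarrow> 0) at_bot"
    by (simp add: filterlim_at_bot_mirror)
  then have "F x = G x" for x
    unfolding gg_cdf_def
    using integral_atMost_FTC_nonneg[of G p 0 x] der isCont_density less_imp_le[OF density_pos]
    by simp
  with der pos refl show thesis using that by blast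
qed

lemma DERIV_cdf: "(F has_real_derivative p x) (at x)"
  by (rule gg_cdf_aux) (metis ext)

lemma cdf_eq: "0 \<le> x \<Longrightarrow> F x = (1 + reg_Gamma a (scaled x)) / 2"
  by (metis gg_cdf_aux)

lemma cdf_minus: "F (- x) = 1 - F x"
  by (metis gg_cdf_aux)

lemma isCont_cdf: "isCont F x"
  using DERIV_cdf DERIV_isCont by blast

lemma cdf_strict_mono: "x < y \<Longrightarrow> F x < F y"
  by (rule DERIV_pos_imp_increasing) (use DERIV_cdf density_pos in blast)+

lemma cdf_mono: "x \<le> y \<Longrightarrow> F x \<le> F y"
  using cdf_strict_mono[of x y] by (cases "x = y") auto

lemma cdf_bounds: "0 < F x" "F x < 1"
proof -
  have less: "F x < 1" if "0 \<le> x" for x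
    using cdf_eq[OF that] reg_Gamma_less_1[OF a_bounds(3) scaled_nonneg[of x]] by simp
  have gt: "0 < F x" if "0 \<le> x" for x
    using cdf_eq[OF that] reg_Gamma_nonneg[OF a_bounds(3) scaled_nonneg[of x]] by simp
  show "0 < F x" "F x < 1"
    using less[of x] gt[of x] less[of "- x"] gt[of "- x"] by (cases "0 \<le> x"; simp add: cdf_minus)+
qed

section \<open>The Mills ratio\<close>

lemma mills_ratio_eq:
  assumes "0 < x"
  shows "g x * (1 - F x) / p x = (1 - reg_Gamma a (scaled x)) / reg_Gamma_density a (scaled x)"
proof -
  have "reg_Gamma_density a (scaled x) \<noteq> 0" "g x \<noteq> 0"
    using reg_Gamma_density_pos[OF a_bounds(3), of "scaled x"] scaled_pos[of x]
      stein_g_pos[OF assms] assms by auto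
  moreover have "1 - F x = (1 - reg_Gamma a (scaled x)) / 2"
    using cdf_eq[of x] assms by simp
  ultimately show ?thesis
    unfolding density_eq_stein_g[OF assms] by simp
qed

lemma mills_ratio_le: "0 \<le> x \<Longrightarrow> g x * (1 - F x) / p x \<le> 1"
proof (cases "x = 0")
  case False
  assume "0 \<le> x"
  then show ?thesis
    using reg_Gamma_upper_tail_le[OF a_bounds(3,2) scaled_pos[OF False]]
      reg_Gamma_density_pos[OF a_bounds(3) scaled_pos[OF False]] False
    by (simp add: mills_ratio_eq pos_divide_le_eq)
qed (simp add: stein_g_def)

lemma mills_ratio_nonneg: "0 \<le> x \<Longrightarrow> 0 \<le> g x * (1 - F x) / p x"
  using stein_g_nonneg[of x] cdf_bounds(2)[of x] density_pos[of x] by simp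

lemma mills_ratio_tendsto: "((\<lambda>x. g x * (1 - F x) / p x) \<longlongrightarrow> 1) at_top"
proof (rule tendsto_sandwich)
  show "((\<lambda>x. 1 - (1 - a) / scaled x) \<longlongrightarrow> 1) at_top"
    using beta lam by real_asymp
  show "\<forall>\<^sub>F x in at_top. 1 - (1 - a) / scaled x \<le> g x * (1 - F x) / p x"
    using eventually_gt_at_top[of 0]
  proof eventually_elim
    case (elim x)
    then have "0 < scaled x" by (intro scaled_pos) simp
    then show ?case
      using reg_Gamma_upper_tail_ge[OF a_bounds(3,2), of "scaled x"]
        reg_Gamma_density_pos[OF a_bounds(3), of "scaled x"]
      unfolding mills_ratio_eq[OF elim]
      by (subst pos_le_divide_eq) (simp_all add: mult.commute)
  qed
  show "\<forall>\<^sub>F x in at_top. g x * (1 - F x) / p x \<le> 1"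
    using eventually_ge_at_top[of 0] by eventually_elim (rule mills_ratio_le)
qed simp

lemma cdf_tendsto_at_top: "(F \<longlongrightarrow> 1) at_top"
proof (rule Lim_transform_eventually)
  have "((\<lambda>x. (1 + reg_Gamma a (scaled x)) / 2) \<longlongrightarrow> (1 + 1) / 2) at_top"
    by (intro tendsto_intros tendsto_reg_Gamma_scaled_at_top) auto
  then show "((\<lambda>x. (1 + reg_Gamma a (scaled x)) / 2) \<longlongrightarrow> 1) at_top"
    by simp
  show "\<forall>\<^sub>F x in at_top. (1 + reg_Gamma a (scaled x)) / 2 = F x"
    using eventually_ge_at_top[of 0] by eventually_elim (simp add: cdf_eq)
qed

section \<open>The Stein solution\<close>

lemma stein_sol_nonneg: "0 \<le> S z x"
  using cdf_bounds[of x] cdf_bounds[of z] density_pos[of x]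
  by (auto simp: stein_sol_def intro!: divide_nonneg_nonneg mult_nonneg_nonneg)

text \<open>By monotonicity of \<open>F\<close>, replacing \<open>z\<close> by \<open>x\<close>
  enlarges the factor depending on \<open>z\<close> in either branch.\<close>

lemma stein_sol_le: "S z x \<le> F x * (1 - F x) / p x"
  using cdf_bounds[of x] cdf_bounds[of z] density_pos[of x] cdf_mono[of x z] cdf_mono[of z x]
  by (auto simp: stein_sol_def intro!: divide_right_mono mult_mono)

lemma stein_sol_diag: "S x x = F x * (1 - F x) / p x"
  by (simp add: stein_sol_def)

lemma envelope_eq: "stein_envelope \<beta> lam x = ereal (F x * (1 - F x) / p x)"
proof -
  have "(SUP z. ereal \<bar>S z x\<bar>) = ereal (F x * (1 - F x) / p x)"
  proof (rule antisym)
    show "(SUP z. ereal \<bar>S z x\<bar>) \<le> ereal (F x * (1 - F x) / p x)"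
      using stein_sol_nonneg stein_sol_le by (intro SUP_least) auto
    have "ereal (F x * (1 - F x) / p x) = ereal \<bar>S x x\<bar>"
      by (subst abs_of_nonneg[OF stein_sol_nonneg]) (simp only: stein_sol_diag)
    also have "\<dots> \<le> (SUP z. ereal \<bar>S z x\<bar>)"
      by (rule SUP_upper) simp
    finally show "ereal (F x * (1 - F x) / p x) \<le> (SUP z. ereal \<bar>S z x\<bar>)" .
  qed
  then show ?thesis by (simp add: stein_envelope_def)
qed

text \<open>By symmetry \<open>F x\<close> and \<open>1 - F x\<close> are, in some order, half of
  one plus and one minus \<open>reg_Gamma a (scaled x)\<close>; the product is the same for both
  signs of \<open>x\<close>.\<close>

lemma envelope_profile:
  "F x * (1 - F x) / p x = Gamma a / (2 * \<beta> * lam powr a)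
     * (exp (scaled x) * (1 - (reg_Gamma a (scaled x))\<^sup>2))"
proof -
  have eq: "F x * (1 - F x) = (1 - (reg_Gamma a (scaled x))\<^sup>2) / 4"
  proof (cases "0 \<le> x")
    case True
    then show ?thesis by (simp add: cdf_eq power2_eq_square field_simps)
  next
    case False
    then have "F (- x) = (1 + reg_Gamma a (scaled x)) / 2"
      using cdf_eq[of "- x"] by simp
    moreover have "F x = 1 - F (- x)" by (simp add: cdf_minus)
    ultimately show ?thesis by (simp only:) (simp add: power2_eq_square field_simps)
  qed
  show ?thesis
    using beta lam less_imp_neq[OF Gamma_real_pos[OF a_bounds(3)]]
    unfolding eq density_eq by (simp add: exp_minus field_simps)
qed

section \<open>The derivative of the Stein solution and its supremum\<close>

lemma DERIV_stein_sol_left: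
  assumes "x < z"
  shows "(S z has_real_derivative (1 - F z) * (1 + g x * F x / p x)) (at x)"
proof -
  \<comment> \<open>The quotient rule with \<open>p' = - g p\<close> reproduces the Stein equation
    \<open>f' = g f + 1 - F z\<close> on this branch.\<close>
  have "((\<lambda>x. F x * (1 - F z) / p x) has_real_derivative (1 - F z) * (1 + g x * F x / p x)) (at x)"
    using density_pos[of x]
    by (auto intro!: derivative_eq_intros DERIV_cdf DERIV_density simp: field_simps)
  then show ?thesis
    by (rule has_field_derivative_transform_within_open[of _ _ _ "{..<z}"])
       (use assms in \<open>auto simp: stein_sol_def\<close>)
qed

lemma DERIV_stein_sol_right:
  assumes "z < x"
  shows "(S z has_real_derivative F z * (g x * (1 - F x) / p x - 1)) (at x)"
proof -
  have "((\<lambda>x. F z * (1 - F x) / p x) has_real_derivative F z * (g x * (1 - F x) / p x - 1)) (at x)"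
    using density_pos[of x]
    by (auto intro!: derivative_eq_intros DERIV_cdf DERIV_density simp: field_simps)
  then show ?thesis
    by (rule has_field_derivative_transform_within_open[of _ _ _ "{z<..}"])
       (use assms in \<open>auto simp: stein_sol_def\<close>)
qed

text \<open>For the extreme value \<open>c = 1 - F x\<close> the expression is a convex combination
  of 1 and the Mills ratio. It serves the left branch at \<open>x \<ge> 0\<close> and, reflected,
  the right branch at negative \<open>x\<close>.\<close>

lemma stein_derivative_bound_aux:
  assumes "0 \<le> x" "0 \<le> c" "c \<le> 1 - F x"
  shows "\<bar>c * (1 + g x * F x / p x)\<bar> \<le> 1"
proof -
  have nn: "0 \<le> g x * F x / p x"
    using stein_g_nonneg[OF assms(1)] cdf_bounds(1)[of x] density_pos[of x] by simp
  then have "c * (1 + g x * F x / p x) \<le> (1 - F x) * (1 + g x * F x / p x)"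
    using assms by (intro mult_right_mono) auto
  also have "\<dots> = (1 - F x) + F x * (g x * (1 - F x) / p x)"
    by (simp add: algebra_simps)
  also have "\<dots> \<le> (1 - F x) + F x * 1"
    using mills_ratio_le[OF assms(1)] cdf_bounds(1)[of x]
    by (intro add_left_mono mult_left_mono) auto
  finally show ?thesis
    using nn assms(2) by (simp add: abs_mult)
qed

text \<open>The Mills ratio lies between 0 and 1, so the bracket has modulus at most 1. This serves
  the right branch at \<open>x \<ge> 0\<close> and, reflected, the left branch at negative
  \<open>x\<close>.\<close>

lemma stein_derivative_bound_aux':
  assumes "0 \<le> x"
  shows "\<bar>F z * (g x * (1 - F x) / p x - 1)\<bar> \<le> 1"
proof -
  have "\<bar>F z\<bar> * \<bar>g x * (1 - F x) / p x - 1\<bar> \<le> 1 * 1"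
    using mills_ratio_le[OF assms] mills_ratio_nonneg[OF assms] cdf_bounds[of z]
    by (intro mult_mono) auto
  then show ?thesis by (simp add: abs_mult)
qed

lemma deriv_stein_sol_bound:
  assumes "x \<noteq> z"
  shows "\<bar>deriv (S z) x\<bar> \<le> 1"
proof (cases "x < z")
  case True
  have eq: "deriv (S z) x = (1 - F z) * (1 + g x * F x / p x)"
    by (rule DERIV_imp_deriv[OF DERIV_stein_sol_left[OF True]])
  show ?thesis
  proof (cases "0 \<le> x")
    case True
    then show ?thesis
      unfolding eq using cdf_bounds[of z] cdf_mono[of x z] \<open>x < z\<close>
      by (intro stein_derivative_bound_aux) auto
  next
    case False
    \<comment> \<open>Reflecting both \<open>x\<close> and \<open>z\<close> exchanges the two
      branches and reverses the sign of the derivative.\<close>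
    have "deriv (S z) x = - (F (- z) * (g (- x) * (1 - F (- x)) / p (- x) - 1))"
      by (simp add: eq cdf_minus algebra_simps diff_divide_distrib)
    then show ?thesis
      using stein_derivative_bound_aux'[of "- x" "- z"] False by simp
  qed
next
  case False
  then have "z < x" using assms by simp
  have eq: "deriv (S z) x = F z * (g x * (1 - F x) / p x - 1)"
    by (rule DERIV_imp_deriv[OF DERIV_stein_sol_right[OF \<open>z < x\<close>]])
  show ?thesis
  proof (cases "0 \<le> x")
    case True
    then show ?thesis unfolding eq by (rule stein_derivative_bound_aux')
  next
    case False
    have "deriv (S z) x = - (F z * (1 + g (- x) * F (- x) / p (- x)))"
      by (simp add: eq cdf_minus algebra_simps diff_divide_distrib)
    then show ?thesis
      using stein_derivative_bound_aux[of "- x" "F z"] False cdf_bounds[of z]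
        cdf_mono[of z x] \<open>z < x\<close>
      by (simp add: cdf_minus)
  qed
qed

lemma stein_sol_differentiable: "x \<noteq> z \<Longrightarrow> S z differentiable (at x)"
  using DERIV_stein_sol_left[of x z] DERIV_stein_sol_right[of z x]
  by (cases x z rule: linorder_cases) (auto simp: real_differentiable_def)

lemma cdf_measurable [measurable]: "F \<in> borel_measurable borel"
  and density_measurable [measurable]: "p \<in> borel_measurable borel"
  and stein_g_measurable [measurable]: "g \<in> borel_measurable borel"
  by (simp_all add: borel_measurable_continuous_onI continuous_at_imp_continuous_on
      isCont_cdf isCont_density isCont_stein_g)

text \<open>The one-sided derivatives differ by 1 at \<open>z\<close>, so the value of
  \<open>deriv\<close> there is split off as a constant; elsewhere the explicit formulas are
  measurable.\<close>

lemma deriv_stein_sol_measurable: "deriv (S z) \<in> borel_measurable borel"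
proof -
  have "deriv (S z) = (\<lambda>x. if x = z then deriv (S z) z
      else if x < z then (1 - F z) * (1 + g x * F x / p x)
      else F z * (g x * (1 - F x) / p x - 1))"
  proof
    show "deriv (S z) x = (if x = z then deriv (S z) z
      else if x < z then (1 - F z) * (1 + g x * F x / p x)
      else F z * (g x * (1 - F x) / p x - 1))" for x
      using DERIV_imp_deriv[OF DERIV_stein_sol_left[of x z]]
        DERIV_imp_deriv[OF DERIV_stein_sol_right[of z x]] by auto
  qed
  also have "\<dots> \<in> borel_measurable borel"
    by measurable
  finally show ?thesis .
qed

lemma deriv_stein_sol_at_left:
  "(deriv (S z) \<longlongrightarrow> (1 - F z) * (1 + g z * F z / p z)) (at_left z)"
proof (rule Lim_transform_eventually)
  have "isCont (\<lambda>x. (1 - F z) * (1 + g x * F x / p x)) z"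
    using isCont_cdf isCont_density isCont_stein_g less_imp_neq[OF density_pos[of z]]
    by (intro continuous_intros) auto
  then show "((\<lambda>x. (1 - F z) * (1 + g x * F x / p x))
      \<longlongrightarrow> (1 - F z) * (1 + g z * F z / p z)) (at_left z)"
    by (auto simp: isCont_def filterlim_at_split)
  show "\<forall>\<^sub>F x in at_left z. (1 - F z) * (1 + g x * F x / p x) = deriv (S z) x"
    using DERIV_imp_deriv[OF DERIV_stein_sol_left]
    by (auto simp: eventually_at_filter)
qed

lemma SUP_ess_sup_norm_deriv: "(SUP z. ess_sup_norm (deriv (S z))) = 1"
proof (rule antisym)
  show "(SUP z. ess_sup_norm (deriv (S z))) \<le> 1"
    using ess_sup_norm_le[OF deriv_stein_sol_measurable deriv_stein_sol_bound]
    by (intro SUP_least) (simp add: one_ereal_def)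
  \<comment> \<open>This is the left limit of the derivative at \<open>z\<close>, rearranged around
    the Mills ratio; it shows that the bound 1 is approached as \<open>z\<close> grows.\<close>
  have "((\<lambda>z. (1 - F z) + F z * (g z * (1 - F z) / p z)) \<longlongrightarrow> (1 - 1) + 1 * 1) at_top"
    by (intro tendsto_intros cdf_tendsto_at_top mills_ratio_tendsto)
  then have lim: "((\<lambda>z. ereal ((1 - F z) * (1 + g z * F z / p z))) \<longlongrightarrow> ereal 1) at_top"
    by (simp add: algebra_simps)
  have le: "ereal ((1 - F z) * (1 + g z * F z / p z)) \<le> (SUP z. ess_sup_norm (deriv (S z)))" for z
    by (rule SUP_upper2[of z], simp,
        rule order_trans[OF _ le_ess_sup_norm[OF deriv_stein_sol_at_left[of z]]])
      (simp only: ereal_less_eq abs_ge_self)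
  show "1 \<le> (SUP z. ess_sup_norm (deriv (S z)))"
    using tendsto_upperbound[OF lim always_eventually[OF allI[OF le]]]
    by (simp add: one_ereal_def)
qed

section \<open>The supremum of the product of \<open>g\<close> with the Stein solution\<close>

lemma stein_g_sol_bound: "\<bar>g x * S z x\<bar> \<le> 1"
proof -
  have "\<bar>g x * S z x\<bar> \<le> \<bar>g x\<bar> * (F x * (1 - F x) / p x)"
    using stein_sol_le[of z x] stein_sol_nonneg[of z x]
    by (simp add: abs_mult mult_left_mono del: times_divide_eq_right)
  also have "\<dots> \<le> 1"
  proof -
    \<comment> \<open>The product is \<open>F y\<close> times the Mills ratio, both at most 1.
      Negative arguments follow because the envelope is even and \<open>g\<close> is odd.\<close>
    have aux: "g y * (F y * (1 - F y) / p y) \<le> 1" if "0 \<le> y" for y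
    proof -
      have "F y * (g y * (1 - F y) / p y) \<le> 1 * 1"
        using mills_ratio_le[OF that] mills_ratio_nonneg[OF that] cdf_bounds[of y]
        by (intro mult_mono) auto
      then show ?thesis by (simp add: mult_ac)
    qed
    show ?thesis
      using aux[of x] aux[of "- x"] stein_g_nonneg[of x] stein_g_nonneg[of "- x"]
      by (cases "0 \<le> x") (simp_all add: cdf_minus mult_ac)
  qed
  finally show ?thesis .
qed

lemma SUP_sup_norm_stein_g_sol: "(SUP z. sup_norm (\<lambda>x. g x * S z x)) = 1"
proof (rule antisym)
  show "(SUP z. sup_norm (\<lambda>x. g x * S z x)) \<le> 1"
    unfolding sup_norm_def using stein_g_sol_bound
    by (intro SUP_least) (simp add: one_ereal_def)
  \<comment> \<open>The values on the diagonal \<open>x = z\<close>, where the solution meets its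
    envelope.\<close>
  have "((\<lambda>z. F z * (g z * (1 - F z) / p z)) \<longlongrightarrow> 1 * 1) at_top"
    by (intro tendsto_intros cdf_tendsto_at_top mills_ratio_tendsto)
  then have lim: "((\<lambda>z. ereal (g z * S z z)) \<longlongrightarrow> ereal 1) at_top"
    by (simp add: stein_sol_diag mult_ac)
  have le: "ereal (g z * S z z) \<le> (SUP z. sup_norm (\<lambda>x. g x * S z x))" for z
    unfolding sup_norm_def
    by (rule SUP_upper2[of z], simp, rule SUP_upper2[of z]) auto
  show "1 \<le> (SUP z. sup_norm (\<lambda>x. g x * S z x))"
    using tendsto_upperbound[OF lim always_eventually[OF allI[OF le]]]
    by (simp add: one_ereal_def)
qed

section \<open>Maximizers of the envelope and the Kolmogorov constant\<close>

lemma crit_u_pos: "0 < crit_u \<beta>"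
  and crit_u_crit: "crit_eq a (crit_u \<beta>)"
  using theI'[OF crit_unique[OF a_bounds(1,2)]] by (auto simp: crit_u_def a_def)

lemma crit_x_pos: "0 < crit_x \<beta> lam"
  using crit_u_pos lam by (simp add: crit_x_def)

lemma scaled_eq_crit_u_iff: "scaled x = crit_u \<beta> \<longleftrightarrow> x = - crit_x \<beta> lam \<or> x = crit_x \<beta> lam"
proof -
  have "crit_u \<beta> = lam * crit_x \<beta> lam powr \<beta>"
    using crit_u_pos lam beta by (simp add: crit_x_def powr_powr)
  then have "scaled x = crit_u \<beta> \<longleftrightarrow> \<bar>x\<bar> powr \<beta> = crit_x \<beta> lam powr \<beta>"
    using lam by (simp only:) simp
  also have "\<dots> \<longleftrightarrow> \<bar>x\<bar> = crit_x \<beta> lam"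
    using crit_x_pos beta powr_less_mono2[of \<beta> "\<bar>x\<bar>" "crit_x \<beta> lam"]
      powr_less_mono2[of \<beta> "crit_x \<beta> lam" "\<bar>x\<bar>"]
    by (cases "\<bar>x\<bar>" "crit_x \<beta> lam" rule: linorder_cases) auto
  also have "\<dots> \<longleftrightarrow> x = - crit_x \<beta> lam \<or> x = crit_x \<beta> lam"
    using crit_x_pos by auto
  finally show ?thesis .
qed

lemma envelope_less_max:
  assumes "scaled x \<noteq> crit_u \<beta>" "scaled y = crit_u \<beta>"
  shows "stein_envelope \<beta> lam x < stein_envelope \<beta> lam y"
proof -
  have "0 < Gamma a / (2 * \<beta> * lam powr a)"
    using beta lam Gamma_real_pos[OF a_bounds(3)] by simp
  from mult_strict_left_mono[OF reg_Gamma_profile_less_max[OF a_bounds(1,2) crit_u_pos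
        crit_u_crit scaled_nonneg assms(1)] this]
  show ?thesis
    by (simp only: envelope_eq envelope_profile assms(2) less_ereal.simps)
qed

lemma envelope_le_max:
  assumes "scaled y = crit_u \<beta>"
  shows "stein_envelope \<beta> lam x \<le> stein_envelope \<beta> lam y"
proof (cases "scaled x = crit_u \<beta>")
  case True
  then show ?thesis using assms by (simp add: envelope_eq envelope_profile)
next
  case False
  then show ?thesis using envelope_less_max assms less_imp_le by blast
qed

lemma scaled_crit_x: "scaled (crit_x \<beta> lam) = crit_u \<beta>"
  using scaled_eq_crit_u_iff[of "crit_x \<beta> lam"] by simp

lemma envelope_maximizers:
  "{x. \<forall>y. stein_envelope \<beta> lam y \<le> stein_envelope \<beta> lam x} = {- crit_x \<beta> lam, crit_x \<beta> lam}"
proof -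
  have "(\<forall>y. stein_envelope \<beta> lam y \<le> stein_envelope \<beta> lam x) \<longleftrightarrow> scaled x = crit_u \<beta>" for x
    using envelope_le_max[of x] envelope_less_max[of x "crit_x \<beta> lam"] scaled_crit_x
    by (auto simp: not_less[symmetric])
  then show ?thesis
    using scaled_eq_crit_u_iff by auto
qed

text \<open>The suprema over \<open>z\<close> and \<open>x\<close> commute, so the constant is the
  supremum of the envelope, attained at its maximizer.\<close>

lemma kolmogorov_const_eq_envelope: "kolmogorov_const \<beta> lam = stein_envelope \<beta> lam (crit_x \<beta> lam)"
proof -
  have "kolmogorov_const \<beta> lam = (SUP x. stein_envelope \<beta> lam x)"
    unfolding kolmogorov_const_def sup_norm_def stein_envelope_def by (rule SUP_commute)
  also have "\<dots> = stein_envelope \<beta> lam (crit_x \<beta> lam)"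
    using envelope_le_max[OF scaled_crit_x]
    by (intro antisym SUP_least SUP_upper) auto
  finally show ?thesis .
qed

lemma kolmogorov_const_eq:
  "kolmogorov_const \<beta> lam = ereal (Gamma a / (2 * \<beta> * lam powr a) * exp (crit_u \<beta>)
     * (1 - (reg_Gamma a (crit_u \<beta>))\<^sup>2))"
  unfolding kolmogorov_const_eq_envelope envelope_eq envelope_profile scaled_crit_x
  by (simp only: mult.assoc)

text \<open>The critical equation trades \<open>1 - P^2\<close> for \<open>2 P q\<close>, and the
  exponential in \<open>q\<close> cancels the factor \<open>exp (crit_u \<beta>)\<close>.\<close>

lemma kolmogorov_const_eq':
  "kolmogorov_const \<beta> lam
     = ereal (reg_Gamma a (crit_u \<beta>) * crit_u \<beta> powr (a - 1) / (\<beta> * lam powr a))"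
proof -
  have eq: "1 - (reg_Gamma a (crit_u \<beta>))\<^sup>2
      = 2 * reg_Gamma a (crit_u \<beta>) * reg_Gamma_density a (crit_u \<beta>)"
    using crit_u_crit crit_eq_iff[OF a_bounds(3) crit_u_pos] by (simp add: crit_fun_def)
  show ?thesis
    using less_imp_neq[OF Gamma_real_pos[OF a_bounds(3)]] beta lam
    unfolding kolmogorov_const_eq eq by (simp add: reg_Gamma_density_def exp_minus field_simps)
qed

text \<open>The left side is the envelope at 0, where \<open>F\<close> is 1/2. The inequality is
  strict since 0 is not a maximizer.\<close>

lemma kolmogorov_const_gt: "ereal (1 / (4 * p 0)) < kolmogorov_const \<beta> lam"
proof -
  have "stein_envelope \<beta> lam 0 < kolmogorov_const \<beta> lam"
    unfolding kolmogorov_const_eq_envelope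
    using crit_u_pos beta by (intro envelope_less_max scaled_crit_x) auto
  moreover have "F 0 = 1 / 2"
    using cdf_eq[of 0] beta by simp
  ultimately show ?thesis by (simp add: envelope_eq)
qed

end

theorem proposition8p5:
  fixes \<beta> lam a :: real
  assumes "1 < \<beta>" and "\<beta> < 2" and "0 < lam" and "a = 1 / \<beta>"
  shows
    "(\<forall>x. stein_envelope \<beta> lam x =
        ereal (gg_cdf \<beta> lam x * (1 - gg_cdf \<beta> lam x) / gg_density \<beta> lam x)) \<and>
     (\<forall>u>0. reg_Gamma a differentiable (at u)) \<and>
     (\<exists>!u. 0 < u \<and> crit_eq a u) \<and>
     {x. \<forall>y. stein_envelope \<beta> lam y \<le> stein_envelope \<beta> lam x}
        = {- crit_x \<beta> lam, crit_x \<beta> lam} \<and>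
     - crit_x \<beta> lam \<noteq> crit_x \<beta> lam \<and>
     kolmogorov_const \<beta> lam =
        ereal (Gamma a / (2 * \<beta> * lam powr a) * exp (crit_u \<beta>)
               * (1 - (reg_Gamma a (crit_u \<beta>))\<^sup>2)) \<and>
     kolmogorov_const \<beta> lam =
        ereal (reg_Gamma a (crit_u \<beta>) * crit_u \<beta> powr (a - 1) / (\<beta> * lam powr a)) \<and>
     kolmogorov_const \<beta> lam > ereal (1 / (4 * gg_density \<beta> lam 0)) \<and>
     (\<forall>z x. x \<noteq> z \<longrightarrow> stein_sol \<beta> lam z differentiable (at x)) \<and>
     (SUP z. ess_sup_norm (deriv (stein_sol \<beta> lam z))) = 1 \<and>
     (SUP z. sup_norm (\<lambda>x. stein_g \<beta> lam x * stein_sol \<beta> lam z x)) = 1"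
proof -
  interpret gen_gauss \<beta> lam a
    using assms by unfold_locales
  have "reg_Gamma a differentiable (at u)" if "0 < u" for u
    using DERIV_reg_Gamma[OF a_bounds(3) that] by (auto simp: real_differentiable_def)
  moreover have "- crit_x \<beta> lam \<noteq> crit_x \<beta> lam"
    using crit_x_pos by simp
  ultimately show ?thesis
    using envelope_eq crit_unique[OF a_bounds(1,2)] envelope_maximizers kolmogorov_const_eq
      kolmogorov_const_eq' kolmogorov_const_gt stein_sol_differentiable
      SUP_ess_sup_norm_deriv SUP_sup_norm_stein_g_sol
    by (intro conjI) auto
qed

end
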